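(* Let $n\ge1$. The meromorphic function $\mathsf{F}(t_1,\dots,t_n)$ satisfies the $q$-difference equation $$\mathsf{F}(qt_1,t_2,\dots,t_n)=\sum_{s=0}^{n-1}(-1)^{s+1}\sum_{1<i_1<\dots<i_s\le n}\mathsf{F}\big(t_1t_{i_1}t_{i_2}\cdots t_{i_s},\,\dots,\widehat{t_{i_1}},\dots,\widehat{t_{i_s}},\dots\big),$$ where in the summand corresponding to $(i_1,\dots,i_s)$ the function $\mathsf{F}$ is the one in $n-s$ variables, its first argument is $t_1t_{i_1}\cdots t_{i_s}$, and its remaining arguments are the $t_j$ with $j\in\{2,\dots,n\}\setminus\{i_1,\dots,i_s\}$ (hats denote omitted terms).
   Context: Infinite wedge space. Let $V$ have basis $\{\underline{k}\}_{k\in\mathbb{Z}+1/2}$. The space $\Lambda^{\frac\infty2}V$ has orthonormal basis $v_S=\underline{s_1}\wedge\underline{s_2}\wedge\cdots$, where $S=\{s_1>s_2>\cdots\}\subset\mathbb{Z}+\frac12$ is such that $S_+=S\setminus\{-\frac12,-\frac32,\dots\}$ and $S_-=\{-\frac12,-\frac32,\dots\}\setminus S$ are finite. The operator $\psi_k$ is exterior multiplication $f\mapsto\underline{k}\wedge f$, $\psi_k^*$ is its adjoint, and $:\!\psi_k\psi_k^*\!:$ equals $\psi_k\psi_k^*$ for $k>0$ and $-\psi_k^*\psi_k$ for $k<0$. The energy operator is $H=\sum_kk:\!\psi_k\psi_k^*\!:$, so $Hv_S=\big(\sum_{k\in S_+\cup S_-}|k|\big)v_S$. For $|t|>1$ let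 $\mathsf{T}(t)=\sum_{k\in\mathbb{Z}+\frac12}t^k\psi_k\psi_k^*$, i.e. $\mathsf{T}(t)v_S=\big(\sum_{k\in S}t^k\big)v_S$. One has $\mathsf{T}(t)=\,:\!\mathsf{T}(t)\!:+\frac{1}{t^{1/2}-t^{-1/2}}$ where $:\!\mathsf{T}(t)\!:\,=\sum_kt^k:\!\psi_k\psi_k^*\!:$ is defined for all $t\neq0$. Fix $q$ with $0<|q|<1$ (and a value of $q^{1/2}$). Define $$\mathsf{F}(t_1,\dots,t_n)=\mathrm{tr}_{\Lambda^{\frac\infty2}V}\big(q^H\,\mathsf{T}(t_1)\mathsf{T}(t_2)\cdots\mathsf{T}(t_n)\big),$$ which converges absolutely for $|t_i|>1$ (all $i$) and $|t_1\cdots t_n|<|q|^{-1}$. Substituting $\mathsf{T}(t_i)=\,:\!\mathsf{T}(t_i)\!:+\frac{1}{t_i^{1/2}-t_i^{-1/2}}$ and expanding, $\mathsf{F}$ extends meromorphically to the domain $\Delta$ of $(t_1,\dots,t_n)$ with $|q|<|t_{i_1}\cdots t_{i_k}|<|q|^{-1}$ for every nonempty subset $\{i_1,\dots,i_k\}\subset\{1,\dots,n\}$; $\mathsf{F}$ denotes the meromorphic function so obtained by analytic continuation, and the equation is an identity of meromorphic functions (for $|t_i|>1$, $|t_1\cdots t_n|<|q|^{-1}$ the point $(qt_1,t_2,\dots,t_n)$ lies in $\Delta$). Half-integer powers are taken with respect to chosen square roots $t_i^{1/2}$, multiplicatively: $(qt_1)^{1/2}=q^{1/2}t_1^{1/2}$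 and $(t_1t_{i_1}\cdots t_{i_s})^{1/2}=t_1^{1/2}t_{i_1}^{1/2}\cdots t_{i_s}^{1/2}$. *)

theory Defs
  imports "HOL-Complex_Analysis.Complex_Analysis"
begin

text \<open>
  A half-integer \<open>k\<close> is represented by the integer \<open>j\<close> with \<open>k = j + 1/2\<close>; thus \<open>k > 0\<close> iff
  \<open>j \<ge> 0\<close>, and \<open>{- 1/2, - 3/2, \<dots>}\<close> is \<open>{..<0}\<close>.  Every parameter \<open>t\<close> (and \<open>q\<close>) enters through a
  chosen square root \<open>u\<close> (and \<open>p\<close>), so that \<open>t\<^sup>k\<close> is \<open>u powi (2 * j + 1)\<close>, and multiplicativity of the
  half-integer powers amounts to multiplying the chosen roots.
\<close>

definition maya :: "int set set" where
  "maya = {S. finite (S \<inter> {0..}) \<and> finite ({..<0} - S)}"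

text \<open>
  Vectors are given by their coefficients with respect to the basis \<open>v\<^sub>S\<close>, \<open>S \<in> maya\<close>; values at
  other sets are irrelevant.
\<close>

type_synonym wedge = "int set \<Rightarrow> complex"

definition basis_vec :: "int set \<Rightarrow> wedge" where
  "basis_vec S = (\<lambda>R. if R = S then 1 else 0)"

definition wedge_inner :: "wedge \<Rightarrow> wedge \<Rightarrow> complex" where
  "wedge_inner f g = (\<Sum>\<^sub>\<infinity>S\<in>maya. f S * cnj (g S))"

text \<open>
  Moving the new factor past the \<open>s \<in> S\<close> with \<open>s > k\<close> into its place produces the sign.
\<close>

definition psi :: "int \<Rightarrow> wedge \<Rightarrow> wedge" where
  "psi j f = (\<lambda>S. if j \<in> S then (-1) ^ card {s\<in>S. s > j} * f (S - {j}) else 0)"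

text \<open>
  The coefficient of the adjoint at \<open>S\<close> is \<open>\<langle>\<psi>\<^sup>* f, v\<^sub>S\<rangle> = \<langle>f, \<psi> v\<^sub>S\<rangle>\<close>.
\<close>

definition psi_star :: "int \<Rightarrow> wedge \<Rightarrow> wedge" where
  "psi_star j f = (\<lambda>S. wedge_inner f (psi j (basis_vec S)))"

definition nord_psi :: "int \<Rightarrow> wedge \<Rightarrow> wedge" where
  "nord_psi j f = (if j \<ge> 0 then psi j (psi_star j f) else (\<lambda>S. - psi_star j (psi j f) S))"

definition energy_op :: "wedge \<Rightarrow> wedge" where
  "energy_op f = (\<lambda>S. \<Sum>\<^sub>\<infinity>j. (of_int j + 1/2) * nord_psi j f S)"

text \<open>
  Twice the energy \<open>\<Sum>k\<in>S\<^sub>+ \<union> S\<^sub>-. \<bar>k\<bar>\<close> of \<open>v\<^sub>S\<close>; see \<open>energy_op_basis_vec\<close> below.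
\<close>

definition energy2 :: "int set \<Rightarrow> nat" where
  "energy2 S = (\<Sum>j \<in> (S \<inter> {0..}) \<union> ({..<0} - S). nat \<bar>2 * j + 1\<bar>)"

text \<open>The operator \<open>q\<^sup>H\<close>, where \<open>p\<close> is the chosen square root of \<open>q\<close>.\<close>

definition q_pow_H :: "complex \<Rightarrow> wedge \<Rightarrow> wedge" where
  "q_pow_H p f = (\<lambda>S. p ^ energy2 S * f S)"

definition T_op :: "complex \<Rightarrow> wedge \<Rightarrow> wedge" where
  "T_op u f = (\<lambda>S. \<Sum>\<^sub>\<infinity>j. u powi (2 * j + 1) * psi j (psi_star j f) S)"

definition nord_T_op :: "complex \<Rightarrow> wedge \<Rightarrow> wedge" where
  "nord_T_op u f = (\<lambda>S. \<Sum>\<^sub>\<infinity>j. u powi (2 * j + 1) * nord_psi j f S)"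

definition wedge_trace :: "(wedge \<Rightarrow> wedge) \<Rightarrow> complex" where
  "wedge_trace A = (\<Sum>\<^sub>\<infinity>S\<in>maya. wedge_inner (A (basis_vec S)) (basis_vec S))"

definition op_prod :: "(wedge \<Rightarrow> wedge) list \<Rightarrow> wedge \<Rightarrow> wedge" where
  "op_prod As = foldr (\<circ>) As id"

text \<open>
  The trace of \<open>q\<^sup>H T(t\<^sub>1) \<dots> T(t\<^sub>n)\<close>, in the roots \<open>u\<^sub>i\<close> of the \<open>t\<^sub>i\<close>.  It is only meaningful on its domain
  of convergence \<open>conv_dom\<close>.
\<close>

definition F_trace :: "complex \<Rightarrow> complex list \<Rightarrow> complex" where
  "F_trace p us = wedge_trace (q_pow_H p \<circ> op_prod (map T_op us))"

definition conv_dom :: "complex \<Rightarrow> complex list set" where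
  "conv_dom q = {ts. (\<forall>t\<in>set ts. norm t > 1) \<and> norm (prod_list ts) < 1 / norm q}"

definition Delta :: "complex \<Rightarrow> complex list set" where
  "Delta q = {ts. \<forall>J. J \<subseteq> {..<length ts} \<and> J \<noteq> {} \<longrightarrow>
                norm q < norm (\<Prod>i\<in>J. ts ! i) \<and> norm (\<Prod>i\<in>J. ts ! i) < 1 / norm q}"

text \<open>
  The analytic continuation of \<open>F_trace\<close>, obtained by inserting
  \<open>T(t\<^sub>i) = :T(t\<^sub>i): + 1 / (u\<^sub>i - 1 / u\<^sub>i)\<close> and expanding; \<open>I\<close> is the set of positions at which the
  normally ordered summand is chosen.  The normally ordered traces converge absolutely on
  \<open>Delta\<close>, so the poles there are at \<open>t\<^sub>i = 1\<close>, and \<open>F_mer\<close> is evaluated on \<open>regular_dom\<close> only.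
  That this is the continuation is shown in \<open>F_mer_eq_F_trace\<close> and \<open>F_mer_holomorphic\<close>.
\<close>

definition nord_F :: "complex \<Rightarrow> complex list \<Rightarrow> complex" where
  "nord_F p us = wedge_trace (q_pow_H p \<circ> op_prod (map nord_T_op us))"

definition F_mer :: "complex \<Rightarrow> complex list \<Rightarrow> complex" where
  "F_mer p us = (\<Sum>I\<in>Pow {..<length us}.
      nord_F p (nths us I) * (\<Prod>i\<in>{..<length us} - I. 1 / (us ! i - 1 / us ! i)))"

definition regular_dom :: "complex \<Rightarrow> complex list set" where
  "regular_dom q = {ts \<in> Delta q. \<forall>t\<in>set ts. t \<noteq> 1}"

definition squares :: "complex list \<Rightarrow> complex list" where
  "squares us = map (\<lambda>u. u ^ 2) us"

subsection \<open>The operators in the basis\<close>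

lemma wedge_inner_basis_vec: "S \<in> maya \<Longrightarrow> wedge_inner f (basis_vec S) = f S"
proof -
  assume S: "S \<in> maya"
  have "wedge_inner f (basis_vec S) = (\<Sum>\<^sub>\<infinity>R\<in>{S}. f R * cnj (basis_vec S R))"
    unfolding wedge_inner_def using S by (intro infsum_cong_neutral) (auto simp: basis_vec_def)
  thus ?thesis by (simp add: basis_vec_def)
qed

lemma maya_insert: "S \<in> maya \<Longrightarrow> insert j S \<in> maya"
proof -
  assume S: "S \<in> maya"
  have "insert j S \<inter> {0..} \<subseteq> insert j (S \<inter> {0..})" "{..<0} - insert j S \<subseteq> {..<0} - S"
    by auto
  with S show ?thesis unfolding maya_def by (auto intro: finite_subset)
qed

lemma maya_remove: "S \<in> maya \<Longrightarrow> S - {j} \<in> maya"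
proof -
  assume S: "S \<in> maya"
  have "(S - {j}) \<inter> {0..} \<subseteq> S \<inter> {0..}" "{..<0} - (S - {j}) \<subseteq> insert j ({..<0} - S)"
    by auto
  with S show ?thesis unfolding maya_def by (auto intro: finite_subset)
qed

lemma psi_star_eq:
  assumes "S \<in> maya"
  shows "psi_star j f S = (if j \<in> S then 0 else (-1) ^ card {s\<in>S. s > j} * f (insert j S))"
proof (cases "j \<in> S")
  case True
  have "psi j (basis_vec S) = (\<lambda>_. 0)"
    using True by (auto simp: psi_def basis_vec_def)
  thus ?thesis using True by (simp add: psi_star_def wedge_inner_def)
next
  case False
  have "psi_star j f S = (\<Sum>\<^sub>\<infinity>R\<in>{insert j S}. f R * cnj (psi j (basis_vec S) R))"
    unfolding psi_star_def wedge_inner_def using False assms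
    by (intro infsum_cong_neutral) (auto simp: psi_def basis_vec_def maya_insert insert_absorb)
  also have "{s \<in> insert j S. j < s} = {s \<in> S. j < s}" by auto
  hence "(\<Sum>\<^sub>\<infinity>R\<in>{insert j S}. f R * cnj (psi j (basis_vec S) R))
      = (-1) ^ card {s\<in>S. s > j} * f (insert j S)"
    using False by (simp add: psi_def basis_vec_def)
  finally show ?thesis using False by simp
qed

lemma psi_star_adjoint:
  assumes "finite {S. f S \<noteq> 0}"
  shows "wedge_inner (psi j f) g = wedge_inner f (psi_star j g)"
proof -
  have "wedge_inner (psi j f) g = (\<Sum>\<^sub>\<infinity>S\<in>{S\<in>maya. j \<in> S}. psi j f S * cnj (g S))"
    unfolding wedge_inner_def by (intro infsum_cong_neutral) (auto simp: psi_def)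
  also have "\<dots> = (\<Sum>\<^sub>\<infinity>S\<in>{S\<in>maya. j \<notin> S}. f S * cnj (psi_star j g S))"
  proof (rule infsum_reindex_bij_witness[where i = "insert j" and j = "\<lambda>S. S - {j}"])
    fix S assume "S \<in> {S \<in> maya. j \<in> S}"
    hence S: "S \<in> maya" "j \<in> S" by auto
    have "{s \<in> S. s \<noteq> j \<and> j < s} = {s \<in> S. j < s}" by auto
    thus "f (S - {j}) * cnj (psi_star j g (S - {j})) = psi j f S * cnj (g S)"
      using S by (simp add: psi_star_eq maya_remove psi_def insert_absorb)
  qed (auto simp: maya_insert maya_remove)
  also have "\<dots> = wedge_inner f (psi_star j g)"
    unfolding wedge_inner_def by (intro infsum_cong_neutral) (auto simp: psi_star_eq)
  finally show ?thesis .
qed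

lemma psi_psi_star: "S \<in> maya \<Longrightarrow> psi j (psi_star j f) S = (if j \<in> S then f S else 0)"
proof -
  assume S: "S \<in> maya"
  have "{s \<in> S. s \<noteq> j \<and> j < s} = {s \<in> S. j < s}" by auto
  with S show ?thesis
    by (simp add: psi_def psi_star_eq maya_remove insert_absorb mult.assoc[symmetric] power_add[symmetric])
qed

lemma psi_star_psi: "S \<in> maya \<Longrightarrow> psi_star j (psi j f) S = (if j \<in> S then 0 else f S)"
proof -
  assume S: "S \<in> maya"
  have *: "{s. (s = j \<or> s \<in> S) \<and> j < s} = {s \<in> S. j < s}" by auto
  with S show ?thesis
    by (simp add: psi_def psi_star_eq mult.assoc[symmetric] power_add[symmetric])
qed

lemma nord_psi_eq:
  "S \<in> maya \<Longrightarrow> nord_psi j f S =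
     (if j \<in> S \<inter> {0..} then f S else if j \<in> {..<0} - S then - f S else 0)"
  by (auto simp: nord_psi_def psi_psi_star psi_star_psi)

definition nord_eig :: "complex \<Rightarrow> int set \<Rightarrow> complex" where
  "nord_eig u S = (\<Sum>j\<in>S \<inter> {0..}. u powi (2 * j + 1)) - (\<Sum>j\<in>{..<0} - S. u powi (2 * j + 1))"

lemma infsum_nord_psi:
  assumes S: "S \<in> maya"
  shows "(\<Sum>\<^sub>\<infinity>j. c j * nord_psi j f S)
       = ((\<Sum>j\<in>S \<inter> {0..}. c j) - (\<Sum>j\<in>{..<0} - S. c j)) * f S"
proof -
  have fin: "finite (S \<inter> {0..})" "finite ({..<0} - S)" using S by (auto simp: maya_def)
  have "(\<Sum>\<^sub>\<infinity>j. c j * nord_psi j f S)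
      = (\<Sum>\<^sub>\<infinity>j\<in>(S \<inter> {0..}) \<union> ({..<0} - S). c j * nord_psi j f S)"
    using S by (intro infsum_cong_neutral) (auto simp: nord_psi_eq)
  also have "\<dots> = (\<Sum>j\<in>(S \<inter> {0..}) \<union> ({..<0} - S). c j * nord_psi j f S)"
    using fin by (intro infsum_finite) auto
  also have "\<dots> = (\<Sum>j\<in>S \<inter> {0..}. c j * nord_psi j f S) + (\<Sum>j\<in>{..<0} - S. c j * nord_psi j f S)"
    using fin by (intro sum.union_disjoint) auto
  also have "(\<Sum>j\<in>S \<inter> {0..}. c j * nord_psi j f S) = (\<Sum>j\<in>S \<inter> {0..}. c j * f S)"
    using S by (intro sum.cong) (auto simp: nord_psi_eq)
  also have "(\<Sum>j\<in>{..<0} - S. c j * nord_psi j f S) = (\<Sum>j\<in>{..<0} - S. c j * (- f S))"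
    using S by (intro sum.cong) (auto simp: nord_psi_eq)
  finally show ?thesis by (simp add: sum_distrib_right sum_negf left_diff_distrib)
qed

lemma nord_T_op_eq: "S \<in> maya \<Longrightarrow> nord_T_op u f S = nord_eig u S * f S"
  by (simp add: nord_T_op_def nord_eig_def infsum_nord_psi)

lemma energy_op_eq: 
  assumes S: "S \<in> maya"
  shows "energy_op f S = of_nat (energy2 S) / 2 * f S"
proof -
  have fin: "finite (S \<inter> {0..})" "finite ({..<0} - S)" using S by (auto simp: maya_def)
  have "of_nat (energy2 S) = (\<Sum>j\<in>S \<inter> {0..}. of_nat (nat \<bar>2 * j + 1\<bar>)) 
      + (\<Sum>j\<in>{..<0} - S. of_nat (nat \<bar>2 * j + 1\<bar>) :: complex)"
    unfolding energy2_def of_nat_sum using fin by (intro sum.union_disjoint) auto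
  also have "(\<Sum>j\<in>S \<inter> {0..}. of_nat (nat \<bar>2 * j + 1\<bar>)) = (\<Sum>j\<in>S \<inter> {0..}. 2 * (of_int j + 1/2) :: complex)"
    by (intro sum.cong) (auto simp: algebra_simps)
  also have "(\<Sum>j\<in>{..<0} - S. of_nat (nat \<bar>2 * j + 1\<bar>)) = (\<Sum>j\<in>{..<0} - S. - (2 * (of_int j + 1/2)) :: complex)"
    by (intro sum.cong) (auto simp: algebra_simps)
  finally have "of_nat (energy2 S) / 2 = (\<Sum>j\<in>S \<inter> {0..}. of_int j + 1/2)
      - (\<Sum>j\<in>{..<0} - S. of_int j + 1/2 :: complex)"
    unfolding sum_negf sum_distrib_left[symmetric] by simp
  thus ?thesis using S by (simp add: energy_op_def infsum_nord_psi)
qed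

lemma energy_op_basis_vec:
  "S \<in> maya \<Longrightarrow> R \<in> maya \<Longrightarrow> energy_op (basis_vec S) R = of_nat (energy2 S) / 2 * basis_vec S R"
  by (simp add: energy_op_eq basis_vec_def)

lemma has_sum_negative_powers:
  fixes u :: complex
  assumes "norm u > 1"
  shows "((\<lambda>j. u powi (2 * j + 1)) has_sum (1 / (u - 1 / u))) {..<0}"
proof -
  have u: "u \<noteq> 0" using assms by auto
  have u2: "norm (inverse u ^ 2) < 1"
    using assms by (simp add: norm_power norm_inverse power_inverse inverse_less_1_iff)
  have "(\<lambda>n. (inverse u ^ 2) ^ n) sums (1 / (1 - inverse u ^ 2))"
    by (rule geometric_sums[OF u2])
  moreover have "summable (\<lambda>n. norm ((inverse u ^ 2) ^ n))"
    using u2 by (simp only: norm_power summable_geometric_iff) (simp add: norm_power)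
  ultimately have "((\<lambda>n. (inverse u ^ 2) ^ n) has_sum (1 / (1 - inverse u ^ 2))) UNIV"
    by (rule norm_summable_imp_has_sum[rotated])
  hence "((\<lambda>n. inverse u * (inverse u ^ 2) ^ n) has_sum (inverse u * (1 / (1 - inverse u ^ 2)))) UNIV"
    by (rule has_sum_cmult_right)
  also have "inverse u * (1 / (1 - inverse u ^ 2)) = 1 / (u - 1 / u)"
  proof -
    have "u * (1 - inverse u ^ 2) = u - 1 / u" using u by (simp add: field_simps power2_eq_square)
    thus ?thesis by (metis inverse_eq_divide inverse_mult_distrib)
  qed
  also have "((\<lambda>n. inverse u * (inverse u ^ 2) ^ n) has_sum (1 / (u - 1 / u))) UNIV
      \<longleftrightarrow> ((\<lambda>j. u powi (2 * j + 1)) has_sum (1 / (u - 1 / u))) {..<0}"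
  proof (rule has_sum_reindex_bij_witness[where i = "\<lambda>j. nat (- j - 1)" and j = "\<lambda>n. - int n - 1"])
    fix n :: nat
    have "u powi (2 * (- int n - 1) + 1) = u powi (- int (Suc (2 * n)))"
      by (rule arg_cong[where f = "\<lambda>k. u powi k"]) simp
    also have "\<dots> = inverse u * (inverse u ^ 2) ^ n"
      by (simp only: power_int_minus power_int_of_nat power_inverse[symmetric])
         (simp add: power_mult power_inverse)
    finally show "u powi (2 * (- int n - 1) + 1) = inverse u * (inverse u ^ 2) ^ n" .
  qed auto
  finally show ?thesis .
qed

lemma T_op_eq:
  assumes S: "S \<in> maya" and u: "norm u > 1"
  shows "T_op u f S = (nord_eig u S + 1 / (u - 1 / u)) * f S"
proof -
  have fin: "finite (S \<inter> {0..})" "finite ({..<0} - S)" using S by (auto simp: maya_def)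
  let ?c = "\<lambda>j. u powi (2 * j + 1)"
  have "(?c has_sum (1 / (u - 1 / u) - (\<Sum>j\<in>{..<0} - S. ?c j))) ({..<0} - ({..<0} - S))"
    using has_sum_Diff[OF has_sum_negative_powers[OF u] has_sum_finite[OF fin(2)]] by auto
  moreover have "{..<0} - ({..<0} - S) = S \<inter> {..<0}" by auto
  ultimately have "(?c has_sum (1 / (u - 1 / u) - (\<Sum>j\<in>{..<0} - S. ?c j))) (S \<inter> {..<0})" by simp
  moreover have "S \<inter> {0..} \<inter> (S \<inter> {..<0}) = {}" by auto
  ultimately have "(?c has_sum ((\<Sum>j\<in>S \<inter> {0..}. ?c j) + (1 / (u - 1 / u) - (\<Sum>j\<in>{..<0} - S. ?c j))))
      (S \<inter> {0..} \<union> S \<inter> {..<0})"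
    by (intro has_sum_Un_disjoint has_sum_finite fin)
  hence "(?c has_sum (nord_eig u S + 1 / (u - 1 / u))) (S \<inter> {0..} \<union> S \<inter> {..<0})"
    by (simp add: nord_eig_def add_diff_eq diff_add_eq)
  moreover have "S \<inter> {0..} \<union> S \<inter> {..<0} = S" by auto
  ultimately have hs: "(?c has_sum (nord_eig u S + 1 / (u - 1 / u))) S" by simp
  have "T_op u f S = (\<Sum>\<^sub>\<infinity>j\<in>S. ?c j * f S)"
    unfolding T_op_def using S by (intro infsum_cong_neutral) (auto simp: psi_psi_star)
  also have "\<dots> = (nord_eig u S + 1 / (u - 1 / u)) * f S"
    by (intro infsumI has_sum_cmult_left hs)
  finally show ?thesis .
qed

lemma T_op_eq_nord_T_op:
  "S \<in> maya \<Longrightarrow> norm u > 1 \<Longrightarrow> T_op u f S = nord_T_op u f S + 1 / (u - 1 / u) * f S"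
  by (simp add: T_op_eq nord_T_op_eq algebra_simps)

lemma op_prod_map_diag:
  assumes "\<And>u f S. u \<in> set us \<Longrightarrow> S \<in> maya \<Longrightarrow> A u f S = e u S * f S" "S \<in> maya"
  shows "op_prod (map A us) f S = prod_list (map (\<lambda>u. e u S) us) * f S"
  using assms(1)
proof (induction us)
  case (Cons u us)
  have "op_prod (map A (u # us)) f S = A u (op_prod (map A us) f) S" by (simp add: op_prod_def)
  also have "\<dots> = e u S * op_prod (map A us) f S" using Cons.prems assms(2) by simp
  finally show ?case using Cons by (simp add: mult.assoc)
qed (simp add: op_prod_def)

lemma nord_F_eq:
  "nord_F p us = (\<Sum>\<^sub>\<infinity>S\<in>maya. p ^ energy2 S * prod_list (map (\<lambda>u. nord_eig u S) us))"
proof -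
  have "op_prod (map nord_T_op us) f S = prod_list (map (\<lambda>u. nord_eig u S) us) * f S"
    if "S \<in> maya" for f S
    using that by (intro op_prod_map_diag nord_T_op_eq) auto
  thus ?thesis unfolding nord_F_def wedge_trace_def
    by (intro infsum_cong) (simp add: wedge_inner_basis_vec q_pow_H_def, simp add: basis_vec_def)
qed

lemma F_trace_eq:
  assumes "\<forall>u\<in>set us. norm u > 1"
  shows "F_trace p us = (\<Sum>\<^sub>\<infinity>S\<in>maya. p ^ energy2 S * 
           prod_list (map (\<lambda>u. nord_eig u S + 1 / (u - 1 / u)) us))"
proof -
  have "op_prod (map T_op us) f S = prod_list (map (\<lambda>u. nord_eig u S + 1 / (u - 1 / u)) us) * f S"
    if "S \<in> maya" for f S
    using that assms by (intro op_prod_map_diag T_op_eq) auto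
  thus ?thesis unfolding F_trace_def wedge_trace_def
    by (intro infsum_cong) (simp add: wedge_inner_basis_vec q_pow_H_def, simp add: basis_vec_def)
qed

lemma prod_list_nths:
  "prod_list (map f (nths us I)) = (\<Prod>i\<in>I \<inter> {..<length us}. f (us ! i) :: 'b :: comm_monoid_mult)"
proof (induction us rule: rev_induct)
  case (snoc x xs)
  have "(\<Prod>i\<in>I \<inter> {..<length xs}. f ((xs @ [x]) ! i)) = (\<Prod>i\<in>I \<inter> {..<length xs}. f (xs ! i))"
    by (intro prod.cong) (auto simp: nth_append)
  moreover have "I \<inter> {..<Suc (length xs)} =
      (if length xs \<in> I then insert (length xs) (I \<inter> {..<length xs}) else I \<inter> {..<length xs})"
    by (auto simp: less_Suc_eq)
  ultimately show ?case using snoc by (simp add: nths_append mult.commute)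
qed simp

subsection \<open>Absolute convergence\<close>

definition modes :: "int set \<Rightarrow> int set" where
  "modes S = (S \<inter> {0..}) \<union> ({..<0} - S)"

lemma finite_modes: "S \<in> maya \<Longrightarrow> finite (modes S)"
  by (simp add: modes_def maya_def)

lemma inj_modes: "inj_on modes A"
proof (rule inj_onI)
  fix S R assume "modes S = modes R"
  hence *: "x \<in> modes S \<longleftrightarrow> x \<in> modes R" for x by simp
  show "S = R"
  proof (rule set_eqI)
    fix x show "x \<in> S \<longleftrightarrow> x \<in> R" using *[of x] by (cases "x < 0") (auto simp: modes_def)
  qed
qed

lemma sum_odd_powers_le:
  assumes x: "0 \<le> x" "x < (1::real)" and A: "finite A"
  shows "(\<Sum>j\<in>A. x ^ nat \<bar>2 * j + 1\<bar>) \<le> 2 / (1 - x)"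
proof -
  have half: "(\<Sum>j\<in>B. x ^ nat \<bar>2 * j + 1\<bar>) \<le> 1 / (1 - x)"
    if "finite B" "inj_on (\<lambda>j. nat \<bar>2 * j + 1\<bar>) B" for B
  proof -
    have "(\<Sum>j\<in>B. x ^ nat \<bar>2 * j + 1\<bar>) = (\<Sum>n\<in>(\<lambda>j. nat \<bar>2 * j + 1\<bar>) ` B. x ^ n)"
      using that by (simp add: sum.reindex o_def)
    also have "\<dots> \<le> (\<Sum>n. x ^ n)"
      using x that by (intro sum_le_suminf summable_geometric) auto
    also have "\<dots> = 1 / (1 - x)" using x by (intro suminf_geometric) auto
    finally show ?thesis .
  qed
  have "(\<Sum>j\<in>A. x ^ nat \<bar>2 * j + 1\<bar>) = (\<Sum>j\<in>(A \<inter> {0..}) \<union> (A \<inter> {..<0}). x ^ nat \<bar>2 * j + 1\<bar>)"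
    by (intro sum.cong) auto
  also have "\<dots> = (\<Sum>j\<in>A \<inter> {0..}. x ^ nat \<bar>2 * j + 1\<bar>) + (\<Sum>j\<in>A \<inter> {..<0}. x ^ nat \<bar>2 * j + 1\<bar>)"
    using A by (intro sum.union_disjoint) auto
  also have "\<dots> \<le> 1 / (1 - x) + 1 / (1 - x)"
    using A by (intro add_mono half) (auto simp: inj_on_def)
  finally show ?thesis by simp
qed

lemma summable_energy:
  assumes x: "0 \<le> x" "x < (1::real)"
  shows "(\<lambda>S. x ^ energy2 S) summable_on maya"
proof (rule nonneg_bdd_above_summable_on)
  let ?w = "\<lambda>j. x ^ nat \<bar>2 * j + 1\<bar>"
  have "(\<Sum>S\<in>X. x ^ energy2 S) \<le> exp (2 / (1 - x))" if X: "X \<subseteq> maya" "finite X" for X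
  proof -
    define U where "U = \<Union> (modes ` X)"
    have finU: "finite U" using X finite_modes unfolding U_def by blast
    have "(\<Sum>S\<in>X. x ^ energy2 S) = (\<Sum>S\<in>X. \<Prod>j\<in>modes S. ?w j)"
      by (simp add: energy2_def modes_def power_sum)
    also have "\<dots> = (\<Sum>D\<in>modes ` X. \<Prod>j\<in>D. ?w j)"
      by (simp add: sum.reindex inj_modes)
    also have "\<dots> \<le> (\<Sum>D\<in>Pow U. \<Prod>j\<in>D. ?w j)"
      using x finU by (intro sum_mono2) (auto simp: U_def intro!: prod_nonneg)
    also have "\<dots> = (\<Prod>j\<in>U. ?w j + 1)"
      using finU by (simp add: prod_add)
    also have "\<dots> \<le> (\<Prod>j\<in>U. exp (?w j))"
      using x by (intro prod_mono) (auto simp: add.commute)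
    also have "\<dots> = exp (\<Sum>j\<in>U. ?w j)" using finU by (simp add: exp_sum)
    also have "\<dots> \<le> exp (2 / (1 - x))" using sum_odd_powers_le[OF x finU] by simp
    finally show ?thesis .
  qed
  thus "bdd_above (sum (\<lambda>S. x ^ energy2 S) ` {F. F \<subseteq> maya \<and> finite F})"
    by (intro bdd_aboveI) auto
qed (use x in auto)

lemma summable_energy_poly:
  assumes x: "0 \<le> x" "x < (1::real)"
  shows "(\<lambda>S. x ^ energy2 S * real (energy2 S) ^ n) summable_on maya"
proof -
  obtain y where y: "x < y" "y < 1" using x dense by blast
  have y0: "0 < y" using x y by linarith
  have "(\<lambda>m. real m ^ n * (x / y) ^ m) \<longlonglongrightarrow> 0"
  proof (cases "n = 0")
    case True
    thus ?thesis using x y y0 by (simp add: LIMSEQ_realpow_zero)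
  next
    case False
    define z where "z = root n (x / y)"
    have z: "z ^ n = x / y" using False x y0 by (simp add: z_def)
    have "norm z < 1" using False x y y0 by (simp add: z_def)
    hence "(\<lambda>m. of_nat m * z ^ m) \<longlonglongrightarrow> 0" by (rule powser_times_n_limit_0)
    hence lim: "(\<lambda>m. (of_nat m * z ^ m) ^ n) \<longlonglongrightarrow> 0" using False by simp
    have "real m ^ n * (x / y) ^ m = (of_nat m * z ^ m) ^ n" for m
    proof -
      have "(z ^ n) ^ m = (z ^ m) ^ n" by (metis power_mult mult.commute)
      thus ?thesis unfolding z by (simp only: power_mult_distrib)
    qed
    hence eq: "(\<lambda>m. real m ^ n * (x / y) ^ m) = (\<lambda>m. (of_nat m * z ^ m) ^ n)" by (rule ext)
    show ?thesis unfolding eq by (rule lim)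
  qed
  hence "Bseq (\<lambda>m. real m ^ n * (x / y) ^ m)"
    by (rule convergent_imp_Bseq[OF convergentI])
  then obtain C where "\<forall>m. norm (real m ^ n * (x / y) ^ m) \<le> C"
    by (rule BseqE)
  hence C: "norm (real m ^ n * (x / y) ^ m) \<le> C" for m ..
  have "(\<lambda>S. C * y ^ energy2 S) summable_on maya"
    using y y0 by (intro summable_on_cmult_right summable_energy) auto
  thus ?thesis
  proof (rule summable_on_comparison_test)
    fix S
    have "x ^ energy2 S * real (energy2 S) ^ n
        = (real (energy2 S) ^ n * (x / y) ^ energy2 S) * y ^ energy2 S"
      using y0 by (simp add: power_divide)
    also have "\<dots> \<le> C * y ^ energy2 S"
      using C[of "energy2 S"] y0 by (intro mult_right_mono) auto
    finally show "x ^ energy2 S * real (energy2 S) ^ n \<le> C * y ^ energy2 S" .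
  qed (use x in auto)
qed

lemma power_int_le_power_abs:
  fixes x Q :: real
  assumes "Q \<ge> 1" "1 / Q \<le> x" "x \<le> Q"
  shows "x powi m \<le> Q ^ nat \<bar>m\<bar>"
proof -
  have x: "x > 0" using assms by (smt (verit) zero_less_divide_1_iff)
  show ?thesis
  proof (cases "m \<ge> 0")
    case True
    thus ?thesis using x assms by (simp add: power_int_def power_mono)
  next
    case False
    have "inverse x \<le> Q" using x assms by (simp add: field_simps)
    thus ?thesis using x False by (simp add: power_int_def power_mono)
  qed
qed

lemma prod_power_int: "(\<Prod>i\<in>A. f i :: real) powi m = (\<Prod>i\<in>A. f i powi m)"
  by (induction A rule: infinite_finite_induct) (auto simp: power_int_mult_distrib)

lemma card_modes_le: 
  assumes "S \<in> maya" 
  shows "card (modes S) \<le> energy2 S"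
proof -
  have "card (modes S) = (\<Sum>j\<in>modes S. 1)" by simp
  also have "\<dots> \<le> (\<Sum>j\<in>modes S. nat \<bar>2 * j + 1\<bar>)"
  proof (rule sum_mono)
    fix j :: int
    have "2 * j + 1 \<noteq> 0" by presburger
    thus "1 \<le> nat \<bar>2 * j + 1\<bar>" by simp
  qed
  finally show ?thesis by (simp add: energy2_def modes_def)
qed

lemma norm_nord_eig_le:
  assumes "S \<in> maya"
  shows "norm (nord_eig u S) \<le> (\<Sum>j\<in>modes S. norm u powi (2 * j + 1))"
proof -
  have fin: "finite (S \<inter> {0..})" "finite ({..<0} - S)" using assms by (auto simp: maya_def)
  have "norm (nord_eig u S) \<le> norm (\<Sum>j\<in>S \<inter> {0..}. u powi (2 * j + 1))
      + norm (\<Sum>j\<in>{..<0} - S. u powi (2 * j + 1))"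
    unfolding nord_eig_def by (rule norm_triangle_ineq4)
  also have "\<dots> \<le> (\<Sum>j\<in>S \<inter> {0..}. norm (u powi (2 * j + 1)))
      + (\<Sum>j\<in>{..<0} - S. norm (u powi (2 * j + 1)))"
    by (intro add_mono norm_sum)
  also have "\<dots> = (\<Sum>j\<in>modes S. norm (u powi (2 * j + 1)))"
    unfolding modes_def using fin by (intro sum.union_disjoint [symmetric]) auto
  finally show ?thesis by (simp add: norm_power_int)
qed

text \<open>
  Expanding the product, each term is a product over the distinct modes that occur, and a mode
  occurring at the positions \<open>J\<close> contributes a power of the product of the \<open>u i\<close>, \<open>i \<in> J\<close>.
\<close>

lemma norm_prod_nord_eig_le:
  assumes S: "S \<in> maya" and I: "finite I" and Q: "Q \<ge> 1"
    and bnd: "\<And>J. J \<subseteq> I \<Longrightarrow> J \<noteq> {} \<Longrightarrow> 1 / Q \<le> (\<Prod>i\<in>J. norm (u i)) \<and> (\<Prod>i\<in>J. norm (u i)) \<le> Q"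
  shows "norm (\<Prod>i\<in>I. nord_eig (u i) S) \<le> Q ^ energy2 S * real (energy2 S) ^ card I"
proof -
  have fin: "finite (modes S)" using S by (rule finite_modes)
  have "norm (\<Prod>i\<in>I. nord_eig (u i) S) = (\<Prod>i\<in>I. norm (nord_eig (u i) S))"
    by (simp add: prod_norm)
  also have "\<dots> \<le> (\<Prod>i\<in>I. \<Sum>j\<in>modes S. norm (u i) powi (2 * j + 1))"
    using S by (intro prod_mono) (auto intro: norm_nord_eig_le)
  also have "\<dots> = (\<Sum>g\<in>I \<rightarrow>\<^sub>E modes S. \<Prod>i\<in>I. norm (u i) powi (2 * g i + 1))"
    using I fin by (intro prod_sum_PiE) auto
  also have "\<dots> \<le> (\<Sum>g\<in>I \<rightarrow>\<^sub>E modes S. Q ^ energy2 S)"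
  proof (rule sum_mono)
    fix g assume g: "g \<in> I \<rightarrow>\<^sub>E modes S"
    have gI: "g ` I \<subseteq> modes S" using g by auto
    have "(\<Prod>i\<in>I. norm (u i) powi (2 * g i + 1))
        = (\<Prod>j\<in>g ` I. \<Prod>i\<in>{i\<in>I. g i = j}. norm (u i) powi (2 * g i + 1))"
      using I by (rule prod.image_gen)
    also have "\<dots> = (\<Prod>j\<in>g ` I. (\<Prod>i\<in>{i\<in>I. g i = j}. norm (u i)) powi (2 * j + 1))"
      unfolding prod_power_int by (intro prod.cong) auto
    also have "\<dots> \<le> (\<Prod>j\<in>g ` I. Q ^ nat \<bar>2 * j + 1\<bar>)"
    proof (intro prod_mono conjI)
      fix j assume j: "j \<in> g ` I"
      have "{i\<in>I. g i = j} \<noteq> {}" using j by auto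
      thus "(\<Prod>i\<in>{i\<in>I. g i = j}. norm (u i)) powi (2 * j + 1) \<le> Q ^ nat \<bar>2 * j + 1\<bar>"
        using bnd[of "{i\<in>I. g i = j}"] Q by (intro power_int_le_power_abs) auto
    qed (auto intro!: zero_le_power_int prod_nonneg)
    also have "\<dots> \<le> (\<Prod>j\<in>modes S. Q ^ nat \<bar>2 * j + 1\<bar>)"
      using gI fin Q by (intro prod_mono2) auto
    also have "\<dots> = Q ^ energy2 S" by (simp add: energy2_def modes_def power_sum)
    finally show "(\<Prod>i\<in>I. norm (u i) powi (2 * g i + 1)) \<le> Q ^ energy2 S" .
  qed
  also have "\<dots> = real (card (modes S)) ^ card I * Q ^ energy2 S"
    using I by (simp add: card_funcsetE)
  also have "\<dots> \<le> real (energy2 S) ^ card I * Q ^ energy2 S"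
    using Q card_modes_le[OF S] by (intro mult_right_mono power_mono) auto
  finally show ?thesis by (simp add: mult.commute)
qed

lemma Delta_squares_bound:
  assumes D: "squares us \<in> Delta (p ^ 2)" and p: "0 < norm p" "norm p < 1"
  obtains Q where "Q \<ge> 1" "norm p * Q < 1"
    "\<And>J. J \<subseteq> {..<length us} \<Longrightarrow> J \<noteq> {} \<Longrightarrow>
       1 / Q < (\<Prod>i\<in>J. norm (us ! i)) \<and> (\<Prod>i\<in>J. norm (us ! i)) < Q"
proof -
  define N where "N J = (\<Prod>i\<in>J. norm (us ! i))" for J
  have N: "norm p < N J" "N J < 1 / norm p" if J: "J \<subseteq> {..<length us}" "J \<noteq> {}" for J
  proof -
    have "(\<Prod>i\<in>J. squares us ! i) = (\<Prod>i\<in>J. (us ! i) ^ 2)"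
      using J by (intro prod.cong) (auto simp: squares_def)
    hence "norm (\<Prod>i\<in>J. squares us ! i) = N J ^ 2"
      by (simp add: N_def prod_power_distrib norm_power flip: prod_norm)
    moreover have "norm (p ^ 2) < norm (\<Prod>i\<in>J. squares us ! i)"
      "norm (\<Prod>i\<in>J. squares us ! i) < 1 / norm (p ^ 2)"
      using D J by (auto simp: Delta_def squares_def)
    ultimately have *: "norm p ^ 2 < N J ^ 2" "N J ^ 2 < (1 / norm p) ^ 2"
      by (simp_all add: norm_power power_divide)
    have "N J \<ge> 0" by (simp add: N_def prod_nonneg)
    thus "norm p < N J" using *(1) by (rule power2_less_imp_less[rotated])
    show "N J < 1 / norm p" using *(2) by (rule power2_less_imp_less) simp
  qed
  define V where "V = insert 1 (N ` (Pow {..<length us} - {{}}) \<union> (\<lambda>J. 1 / N J) ` (Pow {..<length us} - {{}}))"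
  have finV: "finite V" by (simp add: V_def)
  have "v < 1 / norm p" if "v \<in> V" for v
  proof -
    have "1 / N J < 1 / norm p" if "J \<subseteq> {..<length us}" "J \<noteq> {}" for J
      using N(1)[OF that] p by (intro divide_strict_left_mono mult_pos_pos) linarith+
    thus ?thesis using that N p by (auto simp: V_def)
  qed
  hence "Max V < 1 / norm p" using finV by (subst Max_less_iff) (auto simp: V_def)
  then obtain Q where Q: "Max V < Q" "Q < 1 / norm p" using dense by blast
  have V: "v < Q" if "v \<in> V" for v using Max_ge[OF finV that] Q by linarith
  have Q1: "Q > 1" using V[of 1] by (simp add: V_def)
  show ?thesis
  proof (rule that[of Q])
    show "norm p * Q < 1" using Q p by (simp add: field_simps)
  next
    fix J assume J: "J \<subseteq> {..<length us}" "J \<noteq> {}"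
    have "N J < Q" "1 / N J < Q" using J by (auto intro!: V simp: V_def)
    moreover have "N J > 0" using N(1)[OF J] p by linarith
    ultimately have "1 / Q < N J" "N J < Q" using Q1 by (auto simp: field_simps)
    thus "1 / Q < (\<Prod>i\<in>J. norm (us ! i)) \<and> (\<Prod>i\<in>J. norm (us ! i)) < Q" by (simp add: N_def)
  qed (use Q1 in simp)
qed

lemma nord_bound_summable:
  assumes "Q \<ge> 1" "norm p * Q < (1::real)"
  shows "(\<lambda>S. norm (p::complex) ^ energy2 S * (Q ^ energy2 S * real (energy2 S) ^ n)) summable_on maya"
  using summable_energy_poly[of "norm p * Q" n] assms by (simp add: power_mult_distrib mult.assoc)

lemma nord_summable:
  assumes D: "squares us \<in> Delta (p ^ 2)" and p: "0 < norm p" "norm p < 1"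
    and I: "I \<subseteq> {..<length us}"
  shows "(\<lambda>S. norm (p ^ energy2 S * (\<Prod>i\<in>I. nord_eig (us ! i) S))) summable_on maya"
proof -
  obtain Q where Q: "Q \<ge> 1" "norm p * Q < 1"
    "\<And>J. J \<subseteq> {..<length us} \<Longrightarrow> J \<noteq> {} \<Longrightarrow>
       1 / Q < (\<Prod>i\<in>J. norm (us ! i)) \<and> (\<Prod>i\<in>J. norm (us ! i)) < Q"
    using Delta_squares_bound[OF D p] by blast
  show ?thesis
  proof (rule summable_on_comparison_test[OF nord_bound_summable[OF Q(1,2), of "card I"]])
    fix S assume S: "S \<in> maya"
    have "norm (\<Prod>i\<in>I. nord_eig (us ! i) S) \<le> Q ^ energy2 S * real (energy2 S) ^ card I"
      using S finite_subset[OF I] Q I by (intro norm_prod_nord_eig_le) (auto intro: less_imp_le)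
    thus "norm (p ^ energy2 S * (\<Prod>i\<in>I. nord_eig (us ! i) S))
        \<le> norm p ^ energy2 S * (Q ^ energy2 S * real (energy2 S) ^ card I)"
      by (simp add: norm_mult norm_power mult_left_mono)
  qed auto
qed

lemma has_sum_finite_sum:
  fixes f :: "'i \<Rightarrow> 'a \<Rightarrow> complex"
  assumes "finite I" "\<And>i. i \<in> I \<Longrightarrow> (f i has_sum s i) A"
  shows "((\<lambda>x. \<Sum>i\<in>I. f i x) has_sum (\<Sum>i\<in>I. s i)) A"
  using assms by (induction I rule: finite_induct) (auto intro!: has_sum_add)

lemma nord_F_nths_has_sum:
  assumes D: "squares us \<in> Delta (p ^ 2)" and p: "0 < norm p" "norm p < 1"
    and I: "I \<subseteq> {..<length us}"
  shows "((\<lambda>S. p ^ energy2 S * (\<Prod>i\<in>I. nord_eig (us ! i) S)) has_sum nord_F p (nths us I)) maya"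
proof -
  have "I \<inter> {..<length us} = I" using I by auto
  hence "nord_F p (nths us I) = (\<Sum>\<^sub>\<infinity>S\<in>maya. p ^ energy2 S * (\<Prod>i\<in>I. nord_eig (us ! i) S))"
    by (simp add: nord_F_eq prod_list_nths)
  thus ?thesis using abs_summable_summable[OF nord_summable[OF assms]] by simp
qed

lemma F_mer_has_sum:
  assumes D: "squares us \<in> Delta (p ^ 2)" and p: "0 < norm p" "norm p < 1"
  shows "((\<lambda>S. p ^ energy2 S * (\<Prod>i<length us. nord_eig (us ! i) S + 1 / (us ! i - 1 / us ! i)))
           has_sum F_mer p us) maya"
proof -
  let ?n = "{..<length us}" and ?c = "\<lambda>i. 1 / (us ! i - 1 / us ! i)"
  have "((\<lambda>S. \<Sum>I\<in>Pow ?n. p ^ energy2 S * (\<Prod>i\<in>I. nord_eig (us ! i) S) * (\<Prod>i\<in>?n - I. ?c i))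
          has_sum F_mer p us) maya"
    unfolding F_mer_def
    by (intro has_sum_finite_sum has_sum_cmult_left nord_F_nths_has_sum D p) auto
  thus ?thesis by (simp add: prod_add sum_distrib_left mult.assoc)
qed

lemma conv_dom_subset_Delta:
  assumes q: "0 < norm q" "norm q < 1" and ts: "ts \<in> conv_dom q"
  shows "ts \<in> Delta q"
proof -
  have gt: "norm (ts ! i) > 1" if "i < length ts" for i using ts that by (auto simp: conv_dom_def)
  have "norm q < norm (\<Prod>i\<in>J. ts ! i) \<and> norm (\<Prod>i\<in>J. ts ! i) < 1 / norm q"
    if J: "J \<subseteq> {..<length ts}" for J
  proof
    have "1 \<le> (\<Prod>i\<in>J. norm (ts ! i))" using J gt by (intro prod_ge_1) (auto intro: less_imp_le)
    thus "norm q < norm (\<Prod>i\<in>J. ts ! i)" using q by (simp add: prod_norm)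
    have "(\<Prod>i\<in>J. norm (ts ! i)) \<le> (\<Prod>i\<in>{..<length ts}. norm (ts ! i))"
      using J gt by (intro prod_mono2) (auto intro: less_imp_le)
    also have "\<dots> = norm (prod_list ts)"
      by (simp add: prod.list_conv_set_nth atLeast0LessThan prod_norm)
    also have "\<dots> < 1 / norm q" using ts by (simp add: conv_dom_def)
    finally show "norm (\<Prod>i\<in>J. ts ! i) < 1 / norm q" by (simp add: prod_norm)
  qed
  thus ?thesis by (auto simp: Delta_def)
qed

lemma norm_root_gt_1: 
  assumes "norm ((u::complex) ^ 2) > 1" 
  shows "norm u > 1"
  using assms power_le_one[of "norm u" 2] by (force simp: norm_power not_le[symmetric])

theorem F_mer_eq_F_trace:
  assumes p: "0 < norm p" "norm p < 1" and us: "squares us \<in> conv_dom (p ^ 2)"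
  shows "F_mer p us = F_trace p us"
proof -
  have "squares us \<in> Delta (p ^ 2)"
    using p us by (intro conv_dom_subset_Delta) (auto simp: norm_power power_less_one_iff)
  from F_mer_has_sum[OF this p] have "F_mer p us
      = (\<Sum>\<^sub>\<infinity>S\<in>maya. p ^ energy2 S * (\<Prod>i<length us. nord_eig (us ! i) S + 1 / (us ! i - 1 / us ! i)))"
    by (simp add: infsumI)
  moreover have "\<forall>u\<in>set us. norm u > 1"
    using us by (auto simp: conv_dom_def squares_def intro: norm_root_gt_1)
  ultimately show ?thesis
    by (simp add: F_trace_eq prod.list_conv_set_nth atLeast0LessThan)
qed

subsection \<open>Analyticity\<close>

text \<open>
  Holomorphy along all holomorphic curves; in particular in each variable separately.
\<close>

lemma nord_F_holomorphic:
  assumes W: "open W" and p: "0 < norm p" "norm p < 1"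
    and hol: "\<And>f. f \<in> set fs \<Longrightarrow> f holomorphic_on W"
    and D: "\<And>z. z \<in> W \<Longrightarrow> squares (map (\<lambda>f. f z) fs) \<in> Delta (p ^ 2)"
    and I: "I \<subseteq> {..<length fs}"
  shows "(\<lambda>z. nord_F p (nths (map (\<lambda>f. f z) fs) I)) holomorphic_on W"
proof -
  let ?u = "\<lambda>z i. (fs ! i) z"
  let ?g = "\<lambda>S z. p ^ energy2 S * (\<Prod>i\<in>I. nord_eig (?u z i) S)"
  let ?G = "\<lambda>z. nord_F p (nths (map (\<lambda>f. f z) fs) I)"
  have finI: "finite I" using I finite_subset by blast
  have G: "((\<lambda>S. ?g S z) has_sum ?G z) maya" if "z \<in> W" for z
  proof -
    have eq: "(\<Prod>i\<in>I. nord_eig (map (\<lambda>f. f z) fs ! i) S) = (\<Prod>i\<in>I. nord_eig (?u z i) S)" for S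
      using I by (intro prod.cong) auto
    show ?thesis
      using nord_F_nths_has_sum[OF D[OF that] p, of I] I unfolding eq by simp
  qed
  have nz: "?u z i \<noteq> 0" if "z \<in> W" "i < length fs" for z i
  proof
    assume *: "?u z i = 0"
    have "norm (p ^ 2) < norm (\<Prod>k\<in>{i}. squares (map (\<lambda>f. f z) fs) ! k)"
      using D[OF that(1)] that(2) unfolding Delta_def
      by (elim CollectE allE[of _ "{i}"]) (simp add: squares_def)
    thus False using * that p by (simp add: squares_def)
  qed
  have hol_i: "(\<lambda>z. ?u z i) holomorphic_on W" if "i < length fs" for i
    using hol[of "fs ! i"] that by simp
  have hol_g: "?g S holomorphic_on W" for S
    unfolding nord_eig_def using I nz
    by (intro holomorphic_intros hol_i) auto
  have "\<exists>r>0. ball z0 r \<subseteq> W \<and> ?G holomorphic_on ball z0 r" if z0: "z0 \<in> W" for z0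
  proof -
    obtain Q where Q: "Q \<ge> 1" "norm p * Q < 1"
      "\<And>J. J \<subseteq> {..<length fs} \<Longrightarrow> J \<noteq> {} \<Longrightarrow>
         1 / Q < (\<Prod>i\<in>J. norm (map (\<lambda>f. f z0) fs ! i)) \<and> (\<Prod>i\<in>J. norm (map (\<lambda>f. f z0) fs ! i)) < Q"
      using Delta_squares_bound[OF D[OF z0] p] by (auto simp only: length_map)
    have Q3: "1 / Q < (\<Prod>i\<in>J. norm (?u z0 i)) \<and> (\<Prod>i\<in>J. norm (?u z0 i)) < Q"
      if "J \<subseteq> {..<length fs}" "J \<noteq> {}" for J
    proof -
      have "(\<Prod>i\<in>J. norm (map (\<lambda>f. f z0) fs ! i)) = (\<Prod>i\<in>J. norm (?u z0 i))"
        using that by (intro prod.cong) auto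
      thus ?thesis using Q(3)[OF that] by simp
    qed
    have "\<forall>\<^sub>F z in nhds z0. 1 / Q < (\<Prod>i\<in>J. norm (?u z i)) \<and> (\<Prod>i\<in>J. norm (?u z i)) < Q"
      if J: "J \<in> Pow {..<length fs} - {{}}" for J
    proof -
      have "isCont (\<lambda>z. ?u z i) z0" if "i < length fs" for i
        using hol_i[OF that] W z0 holomorphic_on_imp_continuous_on continuous_on_eq_continuous_at by blast
      hence "isCont (\<lambda>z. \<Prod>i\<in>J. norm (?u z i)) z0"
        using J by (intro continuous_intros) auto
      hence "((\<lambda>z. \<Prod>i\<in>J. norm (?u z i)) \<longlongrightarrow> (\<Prod>i\<in>J. norm (?u z0 i))) (nhds z0)"
        using tendsto_at_iff_tendsto_nhds[of "\<lambda>z. \<Prod>i\<in>J. norm (?u z i)" z0]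
        by (simp add: isCont_def)
      thus ?thesis using Q3[of J] J
        by (intro eventually_conj order_tendstoD) auto
    qed
    hence "\<forall>\<^sub>F z in nhds z0. \<forall>J\<in>Pow {..<length fs} - {{}}.
        1 / Q < (\<Prod>i\<in>J. norm (?u z i)) \<and> (\<Prod>i\<in>J. norm (?u z i)) < Q"
      by (intro eventually_ball_finite) auto
    moreover have "\<forall>\<^sub>F z in nhds z0. z \<in> W" using W z0 by (rule eventually_nhds_in_open)
    ultimately have "\<forall>\<^sub>F z in nhds z0. z \<in> W \<and> (\<forall>J\<in>Pow {..<length fs} - {{}}.
        1 / Q < (\<Prod>i\<in>J. norm (?u z i)) \<and> (\<Prod>i\<in>J. norm (?u z i)) < Q)"
      by eventually_elim auto
    then obtain e where e: "e > 0" "\<And>z. dist z z0 < e \<Longrightarrow> z \<in> W \<and> (\<forall>J\<in>Pow {..<length fs} - {{}}.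
        1 / Q < (\<Prod>i\<in>J. norm (?u z i)) \<and> (\<Prod>i\<in>J. norm (?u z i)) < Q)"
      unfolding eventually_nhds_metric by blast
    define r where "r = e / 2"
    have r: "r > 0" "\<And>z. z \<in> cball z0 r \<Longrightarrow> z \<in> W \<and> (\<forall>J\<in>Pow {..<length fs} - {{}}.
        1 / Q < (\<Prod>i\<in>J. norm (?u z i)) \<and> (\<Prod>i\<in>J. norm (?u z i)) < Q)"
      using e by (auto simp: r_def dist_commute)
    have sub: "cball z0 r \<subseteq> W" "ball z0 r \<subseteq> W" using r(2) by (auto simp: less_imp_le)
    have ulim: "uniform_limit (cball z0 r) (\<lambda>X z. \<Sum>S\<in>X. ?g S z) ?G (finite_subsets_at_top maya)"
    proof (rule Weierstrass_m_test_general'[OF _ _ nord_bound_summable[OF Q(1,2), of "card I"]])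
      fix S z assume S: "S \<in> maya" and z: "z \<in> cball z0 r"
      have "norm (\<Prod>i\<in>I. nord_eig (?u z i) S) \<le> Q ^ energy2 S * real (energy2 S) ^ card I"
      proof (rule norm_prod_nord_eig_le[OF S finI Q(1)])
        fix J assume "J \<subseteq> I" "J \<noteq> {}"
        hence "J \<in> Pow {..<length fs} - {{}}" using I by auto
        thus "1 / Q \<le> (\<Prod>i\<in>J. norm (?u z i)) \<and> (\<Prod>i\<in>J. norm (?u z i)) \<le> Q"
          using r(2)[OF z] by (meson less_imp_le)
      qed
      thus "norm (?g S z) \<le> norm p ^ energy2 S * (Q ^ energy2 S * real (energy2 S) ^ card I)"
        by (simp add: norm_mult norm_power mult_left_mono)
    next
      fix z assume "z \<in> cball z0 r"
      thus "((\<lambda>S. ?g S z) has_sum ?G z) maya" using G sub by blast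
    qed
    have cont: "\<forall>\<^sub>F X in finite_subsets_at_top maya.
        continuous_on (cball z0 r) (\<lambda>z. \<Sum>S\<in>X. ?g S z) \<and> (\<lambda>z. \<Sum>S\<in>X. ?g S z) holomorphic_on ball z0 r"
    proof (rule always_eventually, rule allI)
      fix X
      have h: "(\<lambda>z. \<Sum>S\<in>X. ?g S z) holomorphic_on W" by (intro holomorphic_on_sum hol_g)
      show "continuous_on (cball z0 r) (\<lambda>z. \<Sum>S\<in>X. ?g S z) \<and> (\<lambda>z. \<Sum>S\<in>X. ?g S z) holomorphic_on ball z0 r"
        using holomorphic_on_subset[OF h sub(1)] holomorphic_on_subset[OF h sub(2)]
          holomorphic_on_imp_continuous_on by blast
    qed
    have "?G holomorphic_on ball z0 r"
      by (rule holomorphic_uniform_limit[OF cont ulim finite_subsets_at_top_neq_bot])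
    thus ?thesis using r(1) sub(2) by blast
  qed
  hence "?G analytic_on W" unfolding analytic_on_def by blast
  thus ?thesis by (rule analytic_imp_holomorphic)
qed

theorem F_mer_holomorphic:
  assumes W: "open W" and p: "0 < norm p" "norm p < 1"
    and hol: "\<And>f. f \<in> set fs \<Longrightarrow> f holomorphic_on W"
    and D: "\<And>z. z \<in> W \<Longrightarrow> squares (map (\<lambda>f. f z) fs) \<in> regular_dom (p ^ 2)"
  shows "(\<lambda>z. F_mer p (map (\<lambda>f. f z) fs)) holomorphic_on W"
proof -
  have D': "squares (map (\<lambda>f. f z) fs) \<in> Delta (p ^ 2)" if "z \<in> W" for z
    using D[OF that] by (simp add: regular_dom_def)
  have hol_i: "(\<lambda>z. (fs ! i) z) holomorphic_on W" if "i < length fs" for i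
    using hol[of "fs ! i"] that by simp
  have nz: "(fs ! i) z \<noteq> 0" "(fs ! i) z - 1 / (fs ! i) z \<noteq> 0" if "z \<in> W" "i < length fs" for z i
  proof -
    show 0: "(fs ! i) z \<noteq> 0"
    proof
      assume *: "(fs ! i) z = 0"
      have "norm (p ^ 2) < norm (\<Prod>k\<in>{i}. squares (map (\<lambda>f. f z) fs) ! k)"
        using D'[OF that(1)] that(2) unfolding Delta_def
        by (elim CollectE allE[of _ "{i}"]) (simp add: squares_def)
      thus False using * that p by (simp add: squares_def)
    qed
    have "(fs ! i) z ^ 2 \<noteq> 1"
      using D[OF that(1)] that(2) by (auto simp: regular_dom_def squares_def)
    moreover have "(fs ! i) z * ((fs ! i) z - 1 / (fs ! i) z) = (fs ! i) z ^ 2 - 1"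
      using 0 by (simp add: right_diff_distrib power2_eq_square)
    ultimately show "(fs ! i) z - 1 / (fs ! i) z \<noteq> 0" by auto
  qed
  have "(\<lambda>z. \<Sum>I\<in>Pow {..<length fs}. nord_F p (nths (map (\<lambda>f. f z) fs) I) *
      (\<Prod>i\<in>{..<length fs} - I. 1 / ((fs ! i) z - 1 / (fs ! i) z))) holomorphic_on W"
  proof (intro holomorphic_on_sum holomorphic_on_mult holomorphic_on_prod)
    fix I assume "I \<in> Pow {..<length fs}"
    hence I: "I \<subseteq> {..<length fs}" by simp
    show "(\<lambda>z. nord_F p (nths (map (\<lambda>f. f z) fs) I)) holomorphic_on W"
      by (rule nord_F_holomorphic[OF W p _ _ I]) (fact hol, fact D')
  next
    fix I i assume "i \<in> {..<length fs} - I"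
    hence i: "i < length fs" by simp
    show "(\<lambda>z. 1 / ((fs ! i) z - 1 / (fs ! i) z)) holomorphic_on W"
      by (intro holomorphic_on_divide holomorphic_on_diff holomorphic_on_const hol_i i)
         (rule nz[OF _ i], assumption)+
  qed
  moreover have "F_mer p (map (\<lambda>f. f z) fs)
      = (\<Sum>I\<in>Pow {..<length fs}. nord_F p (nths (map (\<lambda>f. f z) fs) I) *
          (\<Prod>i\<in>{..<length fs} - I. 1 / ((fs ! i) z - 1 / (fs ! i) z)))" for z
    unfolding F_mer_def length_map
    by (intro sum.cong prod.cong arg_cong2[where f = "(*)"] refl) (metis DiffD1 lessThan_iff nth_map)
  ultimately show ?thesis by simp
qed

end

theory Submission
  imports Defs
begin

text \<open>
  The regularized eigenvalue of \<open>T(t)\<close> on \<open>v\<^sub>S\<close> is \<open>\<Sum>k\<in>S. t\<^sup>k\<close> for \<open>\<bar>t\<bar> > 1\<close>, but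
  \<open>- (\<Sum>k\<notin>S. t\<^sup>k)\<close> for \<open>\<bar>t\<bar> < 1\<close>.  The domain conditions force \<open>\<bar>q t\<^sub>1\<bar> < 1\<close> and
  \<open>\<bar>t\<^sub>1 t\<^sub>I\<bar> > 1\<close>, so both sides of the equation become absolutely convergent sums over pairs
  \<open>(S, k)\<close>, with \<open>k \<notin> S\<close> on the left and \<open>k \<in> S\<close> on the right.  Inclusion-exclusion over \<open>I\<close> turns
  the factor \<open>\<Prod>i\<ge>2. T(t\<^sub>i)\<close> on the right into \<open>\<Prod>i\<ge>2. (T(t\<^sub>i) - t\<^sub>i\<^sup>k)\<close>, which is the eigenvalue of
  \<open>\<Prod>i\<ge>2. T(t\<^sub>i)\<close> at \<open>S - {k}\<close>, and removing \<open>k\<close> from \<open>S\<close> lowers the energy by \<open>k\<close>, which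
  accounts for the \<open>q\<close> in \<open>q t\<^sub>1\<close>.
\<close>

section \<open>Regularized eigenvalues as convergent sums\<close>

text \<open>For \<open>norm u > 1\<close> the constant is the sum of
  \<open>u powi (2 * j + 1)\<close> over \<open>j < 0\<close>, so \<open>eig\<close> agrees there
  with the eigenvalue of \<open>T_op\<close> and continues it.\<close>

definition eig :: "complex \<Rightarrow> int set \<Rightarrow> complex" where
  "eig u S = nord_eig u S + 1 / (u - 1 / u)"

text \<open>\<open>S\<close> is the negative half-line with finitely many holes and finitely many
  nonnegative elements added; \<open>nord_eig\<close> is exactly this correction to the geometric
  series.\<close>

lemma has_sum_eig_inside:
  assumes S: "S \<in> maya" and u: "norm u > 1"
  shows "((\<lambda>j. u powi (2 * j + 1)) has_sum eig u S) S"
proof -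
  let ?c = "\<lambda>j. u powi (2 * j + 1)"
  have fin: "finite (S \<inter> {0..})" "finite ({..<0} - S)" using S by (auto simp: maya_def)
  have "(?c has_sum (1 / (u - 1 / u) - sum ?c ({..<0} - S))) ({..<0} - ({..<0} - S))"
    using has_sum_Diff[OF has_sum_negative_powers[OF u] has_sum_finite[OF fin(2)]] by auto
  hence "(?c has_sum (sum ?c (S \<inter> {0..}) + (1 / (u - 1 / u) - sum ?c ({..<0} - S))))
      (S \<inter> {0..} \<union> ({..<0} - ({..<0} - S)))"
    by (intro has_sum_Un_disjoint has_sum_finite fin) auto
  moreover have "S \<inter> {0..} \<union> ({..<0} - ({..<0} - S)) = S" by auto
  ultimately show ?thesis by (simp add: eig_def nord_eig_def algebra_simps)
qed

text \<open>The reflection of \<open>j\<close> to \<open>- j - 1\<close> negates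
  \<open>2 * j + 1\<close>, and inverting \<open>u\<close> changes the sign of
  \<open>1 / (u - 1 / u)\<close>.\<close>

lemma has_sum_nonnegative_powers:
  fixes u :: complex
  assumes "0 < norm u" "norm u < 1"
  shows "((\<lambda>j. u powi (2 * j + 1)) has_sum - (1 / (u - 1 / u))) {0..}"
proof -
  have "norm (inverse u) > 1" using assms by (simp add: norm_inverse one_less_inverse_iff)
  from has_sum_negative_powers[OF this]
  have "((\<lambda>j. inverse u powi (2 * j + 1)) has_sum - (1 / (u - 1 / u))) {..<0}"
    by (simp add: inverse_eq_divide minus_divide_right)
  also have "?this \<longleftrightarrow> ?thesis"
  proof (rule has_sum_reindex_bij_witness[where i = "\<lambda>j. - j - 1" and j = "\<lambda>j. - j - 1"])
    fix j :: int
    have "2 * (- j - 1) + 1 = - (2 * j + 1)" by simp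
    thus "u powi (2 * (- j - 1) + 1) = inverse u powi (2 * j + 1)"
      by (simp only: power_int_minus power_int_inverse)
  qed auto
  finally show ?thesis .
qed

text \<open>The complement is the nonnegative half-line with the finite corrections of
  \<open>S\<close> reversed, so both summands of \<open>eig\<close> change sign.\<close>

lemma has_sum_eig_outside:
  assumes S: "S \<in> maya" and u: "0 < norm u" "norm u < 1"
  shows "((\<lambda>j. u powi (2 * j + 1)) has_sum - eig u S) (- S)"
proof -
  let ?c = "\<lambda>j. u powi (2 * j + 1)"
  have fin: "finite (S \<inter> {0..})" "finite ({..<0} - S)" using S by (auto simp: maya_def)
  have "(?c has_sum (- (1 / (u - 1 / u)) - sum ?c (S \<inter> {0..}))) ({0..} - S \<inter> {0..})"
    by (intro has_sum_Diff has_sum_nonnegative_powers u has_sum_finite fin) auto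
  hence "(?c has_sum (sum ?c ({..<0} - S) + (- (1 / (u - 1 / u)) - sum ?c (S \<inter> {0..}))))
      (({..<0} - S) \<union> ({0..} - S \<inter> {0..}))"
    by (intro has_sum_Un_disjoint has_sum_finite fin) auto
  moreover have "({..<0} - S) \<union> ({0..} - S \<inter> {0..}) = - S" by auto
  ultimately show ?thesis by (simp add: eig_def nord_eig_def algebra_simps)
qed

section \<open>Effect of adding one mode\<close>

text \<open>For negative \<open>j\<close> a hole is filled whose term was subtracted, so either sign
  of \<open>j\<close> contributes \<open>+ c j\<close>. A general \<open>c\<close> serves
  eigenvalues and energies alike.\<close>

lemma nord_sum_insert:
  fixes c :: "int \<Rightarrow> 'a :: ab_group_add"
  assumes S: "S \<in> maya" and j: "j \<notin> S"
  shows "sum c (insert j S \<inter> {0..}) - sum c ({..<0} - insert j S)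
       = sum c (S \<inter> {0..}) - sum c ({..<0} - S) + c j"
proof -
  have fin: "finite (S \<inter> {0..})" "finite ({..<0} - S)" using S by (auto simp: maya_def)
  show ?thesis
  proof (cases "j \<ge> 0")
    case True
    have "insert j S \<inter> {0..} = insert j (S \<inter> {0..})" "{..<0} - insert j S = {..<0} - S"
      using True by auto
    thus ?thesis using fin j by simp
  next
    case False
    have "insert j S \<inter> {0..} = S \<inter> {0..}" "{..<0} - insert j S = ({..<0} - S) - {j}"
      using False by auto
    thus ?thesis using fin j False by (simp add: sum_diff1)
  qed
qed

lemma eig_insert: "S \<in> maya \<Longrightarrow> j \<notin> S \<Longrightarrow> eig u (insert j S) = eig u S + u powi (2 * j + 1)"
  by (simp add: eig_def nord_eig_def nord_sum_insert)

text \<open>A hole has \<open>2 * j + 1 < 0\<close>, so its absolute value is the subtracted term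
  and the energy is a normally ordered sum as well.\<close>

lemma energy2_insert:
  assumes "S \<in> maya" "j \<notin> S"
  shows "int (energy2 (insert j S)) = int (energy2 S) + (2 * j + 1)"
proof -
  have "int (energy2 R) = (\<Sum>j\<in>R \<inter> {0..}. 2 * j + 1) - (\<Sum>j\<in>{..<0} - R. 2 * j + 1)"
    if "R \<in> maya" for R
  proof -
    have "finite (R \<inter> {0..})" "finite ({..<0} - R)" using that by (auto simp: maya_def)
    hence "int (energy2 R) = (\<Sum>j\<in>R \<inter> {0..}. \<bar>2 * j + 1\<bar>) + (\<Sum>j\<in>{..<0} - R. \<bar>2 * j + 1\<bar>)"
      unfolding energy2_def of_nat_sum by (subst sum.union_disjoint) auto
    also have "(\<Sum>j\<in>R \<inter> {0..}. \<bar>2 * j + 1\<bar>) = (\<Sum>j\<in>R \<inter> {0..}. 2 * j + 1)"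
      by (intro sum.cong) auto
    also have "(\<Sum>j\<in>{..<0} - R. \<bar>2 * j + 1\<bar>) = (\<Sum>j\<in>{..<0} - R. - (2 * j + 1))"
      by (intro sum.cong) auto
    finally show ?thesis by (simp only: sum_negf diff_conv_add_uminus)
  qed
  thus ?thesis using nord_sum_insert[OF assms, of "\<lambda>j. 2 * j + 1"] assms by (simp add: maya_insert)
qed

lemma power_energy2_insert:
  fixes p :: complex
  assumes "S \<in> maya" "j \<notin> S" "p \<noteq> 0"
  shows "p ^ energy2 (insert j S) = p ^ energy2 S * p powi (2 * j + 1)"
proof -
  \<comment> \<open>The energy drops when \<open>j < 0\<close>, hence the passage to integer
    exponents.\<close>
  have "p ^ energy2 (insert j S) = p powi (int (energy2 S) + (2 * j + 1))"
    unfolding energy2_insert[OF assms(1,2), symmetric] by simp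
  also have "\<dots> = p ^ energy2 S * p powi (2 * j + 1)"
    using assms(3) by (simp only: power_int_add simp_thms power_int_of_nat)
  finally show ?thesis .
qed

section \<open>Absolutely convergent expansions\<close>

text \<open>Only norms of products enter \<open>Delta\<close>; this permits replacing a root by its
  modulus.\<close>

lemma Delta_norm_cong:
  assumes "ts \<in> Delta q" and "map norm ts' = map norm ts"
  shows "ts' \<in> Delta q"
proof -
  have len: "length ts' = length ts" using assms(2) by (metis length_map)
  have "norm (ts' ! i) = norm (ts ! i)" if "i < length ts" for i
    using assms(2) that len by (metis nth_map)
  hence "norm (\<Prod>i\<in>J. ts' ! i) = norm (\<Prod>i\<in>J. ts ! i)" if "J \<subseteq> {..<length ts}" for J
    unfolding prod_norm[symmetric] using that by (intro prod.cong) auto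
  thus ?thesis using assms(1) len by (simp add: Delta_def)
qed

lemma F_mer_has_sum_eig:
  assumes D: "squares us \<in> Delta (p ^ 2)" and p: "0 < norm p" "norm p < 1"
  shows "((\<lambda>S. p ^ energy2 S * prod_list (map (\<lambda>u. eig u S) us)) has_sum F_mer p us) maya"
  using F_mer_has_sum[OF assms]
  by (simp add: prod.list_conv_set_nth atLeast0LessThan eig_def)

lemma summable_on_finite_sum:
  fixes f :: "'i \<Rightarrow> 'a \<Rightarrow> 'b :: topological_comm_monoid_add"
  assumes "finite I" "\<And>i. i \<in> I \<Longrightarrow> f i summable_on A"
  shows "(\<lambda>x. \<Sum>i\<in>I. f i x) summable_on A"
  using assms by (induction I rule: finite_induct) (auto intro!: summable_on_add)

text \<open>Expanding the product leaves finitely many normally ordered series with coefficients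
  independent of \<open>S\<close>, each absolutely summable on \<open>Delta\<close>.\<close>

lemma eig_abs_summable:
  assumes D: "squares us \<in> Delta (p ^ 2)" and p: "0 < norm p" "norm p < 1"
  shows "(\<lambda>S. norm (p ^ energy2 S * prod_list (map (\<lambda>u. eig u S) us))) summable_on maya"
proof -
  let ?n = "{..<length us}" and ?c = "\<lambda>i. 1 / (us ! i - 1 / us ! i)"
  let ?f = "\<lambda>I S. p ^ energy2 S * (\<Prod>i\<in>I. nord_eig (us ! i) S)"
  have "(\<lambda>S. \<Sum>I\<in>Pow ?n. norm (?f I S) * norm (\<Prod>i\<in>?n - I. ?c i)) summable_on maya"
    by (intro summable_on_finite_sum summable_on_cmult_left nord_summable[OF D p]) auto
  thus ?thesis
  proof (rule summable_on_comparison_test)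
    fix S
    have "p ^ energy2 S * prod_list (map (\<lambda>u. eig u S) us)
        = (\<Sum>I\<in>Pow ?n. ?f I S * (\<Prod>i\<in>?n - I. ?c i))"
      by (simp add: prod.list_conv_set_nth atLeast0LessThan eig_def prod_add sum_distrib_left mult.assoc)
    also have "norm \<dots> \<le> (\<Sum>I\<in>Pow ?n. norm (?f I S * (\<Prod>i\<in>?n - I. ?c i)))"
      by (rule norm_sum)
    finally show "norm (p ^ energy2 S * prod_list (map (\<lambda>u. eig u S) us))
        \<le> (\<Sum>I\<in>Pow ?n. norm (?f I S) * norm (\<Prod>i\<in>?n - I. ?c i))"
      by (simp only: norm_mult)
  qed auto
qed

text \<open>
  Replacing \<open>u\<close> by \<open>\<bar>u\<bar>\<close> does not leave the domain, and there the expansion of \<open>eig\<close> consists of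
  the norms of the original terms; this gives absolute convergence of the double sum.
\<close>

lemma F_mer_has_sum_pairs:
  assumes D: "squares (u # us) \<in> Delta (p ^ 2)" and p: "0 < norm p" "norm p < 1"
    and e: "norm e = 1"
    and h: "\<And>w S. norm w = norm u \<Longrightarrow> S \<in> maya \<Longrightarrow>
              ((\<lambda>j. w powi (2 * j + 1)) has_sum e * eig w S) (B S)"
  shows "((\<lambda>(S, j). p ^ energy2 S * u powi (2 * j + 1) * prod_list (map (\<lambda>u. eig u S) us))
           has_sum e * F_mer p (u # us)) (Sigma maya B)"
proof (rule has_sum_SigmaI)
  let ?P = "\<lambda>S. prod_list (map (\<lambda>u. eig u S) us)"
  let ?v = "complex_of_real (norm u)"
  \<comment> \<open>The factor \<open>e\<close> is 1 when \<open>B S = S\<close> and -1 when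
    \<open>B S = - S\<close>.\<close>
  show "((\<lambda>S. e * (p ^ energy2 S * prod_list (map (\<lambda>u. eig u S) (u # us)))) has_sum e * F_mer p (u # us)) maya"
    by (intro has_sum_cmult_right F_mer_has_sum_eig D p)
  show "((\<lambda>j. case (S, j) of (S, j) \<Rightarrow> p ^ energy2 S * u powi (2 * j + 1) * ?P S) has_sum
         e * (p ^ energy2 S * prod_list (map (\<lambda>u. eig u S) (u # us)))) (B S)" if "S \<in> maya" for S
    using has_sum_cmult_right[OF h[OF refl that], of "p ^ energy2 S * ?P S"] by (simp add: mult_ac)
  have real: "((\<lambda>j. norm (u powi (2 * j + 1))) has_sum Re (e * eig ?v S)) (B S)" if "S \<in> maya" for S
  proof -
    have "((\<lambda>j. Re (?v powi (2 * j + 1))) has_sum Re (e * eig ?v S)) (B S)"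
      by (intro has_sum_Re h that) simp
    moreover have "Re (?v powi m) = norm (u powi m)" for m
      by (simp only: of_real_power_int[symmetric] Re_complex_of_real norm_power_int)
    ultimately show ?thesis by simp
  qed
  have "squares (?v # us) \<in> Delta (p ^ 2)"
    by (rule Delta_norm_cong[OF D]) (simp add: squares_def norm_power)
  note summ = eig_abs_summable[OF this p]
  have "(\<lambda>x. norm (case x of (S, j) \<Rightarrow> p ^ energy2 S * u powi (2 * j + 1) * ?P S)) summable_on Sigma maya B"
  proof (rule summable_on_SigmaI)
    show "((\<lambda>j. norm (case (S, j) of (S, j) \<Rightarrow> p ^ energy2 S * u powi (2 * j + 1) * ?P S)) has_sum
            norm (p ^ energy2 S * ?P S) * Re (e * eig ?v S)) (B S)" if "S \<in> maya" for S
      using has_sum_cmult_right[OF real[OF that], of "norm (p ^ energy2 S * ?P S)"]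
      by (simp add: norm_mult mult_ac)
    show "(\<lambda>S. norm (p ^ energy2 S * ?P S) * Re (e * eig ?v S)) summable_on maya"
    proof (rule summable_on_comparison_test[OF summ])
      fix S assume S: "S \<in> maya"
      have "Re (e * eig ?v S) \<le> norm (eig ?v S)"
        using complex_Re_le_cmod[of "e * eig ?v S"] e by (simp add: norm_mult)
      hence "norm (p ^ energy2 S * ?P S) * Re (e * eig ?v S) \<le> norm (p ^ energy2 S * ?P S) * norm (eig ?v S)"
        by (rule mult_left_mono) simp
      thus "norm (p ^ energy2 S * ?P S) * Re (e * eig ?v S)
          \<le> norm (p ^ energy2 S * prod_list (map (\<lambda>u. eig u S) (?v # us)))"
        by (simp add: norm_mult mult_ac)
      have "0 \<le> Re (e * eig ?v S)" using real[OF S] by (rule has_sum_nonneg) simp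
      thus "0 \<le> norm (p ^ energy2 S * ?P S) * Re (e * eig ?v S)" by simp
    qed
  qed auto
  thus "(\<lambda>(S, j). p ^ energy2 S * u powi (2 * j + 1) * ?P S) summable_on Sigma maya B"
    by (rule abs_summable_summable)
qed

lemma F_mer_has_sum_inside:
  assumes "squares (u # us) \<in> Delta (p ^ 2)" "0 < norm p" "norm p < 1" "norm u > 1"
  shows "((\<lambda>(S, j). p ^ energy2 S * u powi (2 * j + 1) * prod_list (map (\<lambda>u. eig u S) us))
           has_sum F_mer p (u # us)) (Sigma maya (\<lambda>S. S))"
  using F_mer_has_sum_pairs[OF assms(1-3), of 1 "\<lambda>S. S"] assms(4)
  by (simp add: has_sum_eig_inside)

lemma F_mer_has_sum_outside:
  assumes "squares (u # us) \<in> Delta (p ^ 2)" "0 < norm p" "norm p < 1" "0 < norm u" "norm u < 1"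
  shows "((\<lambda>(S, j). p ^ energy2 S * u powi (2 * j + 1) * prod_list (map (\<lambda>u. eig u S) us))
           has_sum - F_mer p (u # us)) (Sigma maya (\<lambda>S. - S))"
proof -
  have "((\<lambda>j. w powi (2 * j + 1)) has_sum -1 * eig w S) (- S)"
    if "norm w = norm u" "S \<in> maya" for w S
    using has_sum_eig_outside[OF that(2), of w] that(1) assms(4,5) by simp
  from F_mer_has_sum_pairs[OF assms(1-3) _ this] show ?thesis by simp
qed

section \<open>Inclusion-exclusion and the difference equation\<close>

text \<open>Removing \<open>j\<close> lowers each eigenvalue by \<open>u powi (2 * j + 1)\<close>.
  In the expanded product \<open>I\<close> collects the positions where this power is chosen, and
  these powers merge with that of \<open>x\<close>.\<close>

lemma inclusion_exclusion_eig:
  fixes x :: complex and xs :: "complex list"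
  assumes S: "S \<in> maya" and j: "j \<in> S"
  shows "(\<Sum>I\<in>Pow {..<length xs}. (-1) ^ card I * ((x * (\<Prod>i\<in>I. xs ! i)) powi (2 * j + 1) *
            prod_list (map (\<lambda>u. eig u S) (nths xs (- I)))))
       = x powi (2 * j + 1) * prod_list (map (\<lambda>u. eig u (S - {j})) xs)"
proof -
  let ?n = "{..<length xs}" and ?m = "2 * j + 1"
  have eig: "eig u (S - {j}) = - (u powi ?m) + eig u S" for u
    using eig_insert[of "S - {j}" j u] S j by (simp add: maya_remove insert_absorb)
  have pow: "(\<Prod>i\<in>I. xs ! i) powi ?m = (\<Prod>i\<in>I. xs ! i powi ?m)" for I :: "nat set"
    by (induction I rule: infinite_finite_induct) (auto simp: power_int_mult_distrib)
  have neg: "(\<Prod>i\<in>I. - (xs ! i powi ?m)) = (-1) ^ card I * (\<Prod>i\<in>I. xs ! i) powi ?m"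
    for I :: "nat set"
    unfolding pow using prod.distrib[of "\<lambda>_. -1" "\<lambda>i. xs ! i powi ?m" I] by simp
  have diff: "- I \<inter> ?n = ?n - I" for I :: "nat set" by auto
  have "prod_list (map (\<lambda>u. eig u (S - {j})) xs) = (\<Prod>i\<in>?n. - (xs ! i powi ?m) + eig (xs ! i) S)"
    by (simp add: prod.list_conv_set_nth atLeast0LessThan eig)
  also have "\<dots> = (\<Sum>I\<in>Pow ?n. (-1) ^ card I * (\<Prod>i\<in>I. xs ! i) powi ?m * (\<Prod>i\<in>?n - I. eig (xs ! i) S))"
    by (subst prod_add) (simp_all only: finite_lessThan neg)
  finally show ?thesis
    by (simp add: prod_list_nths diff power_int_mult_distrib sum_distrib_left mult_ac)
qed

text \<open>Position \<open>i\<close> of \<open>xs\<close> holds the root of the variable numbered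
  \<open>i + 2\<close>, and \<open>p * x\<close> is the root of \<open>q\<close> times the first
  variable. The meromorphic identity is asserted pointwise where the arguments of all terms are
  regular.\<close>

theorem theorem6:
  fixes q p :: complex and n :: nat and x :: complex and xs :: "complex list"
  assumes q: "0 < norm q" "norm q < 1" and root: "p ^ 2 = q"
    and n: "n \<ge> 1" "length (x # xs) = n"
    and lhs: "squares (p * x # xs) \<in> regular_dom q"
    and rhs: "\<And>I. I \<subseteq> {..<n - 1} \<Longrightarrow>
                squares (x * (\<Prod>i\<in>I. xs ! i) # nths xs (- I)) \<in> regular_dom q"
  shows "F_mer p (p * x # xs) =
           (\<Sum>s = 0..n - 1. (-1) ^ (s + 1) *
              (\<Sum>I | I \<subseteq> {..<n - 1} \<and> card I = s.
                 F_mer p (x * (\<Prod>i\<in>I. xs ! i) # nths xs (- I))))"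
proof -
  let ?n = "{..<length xs}"
  let ?F = "\<lambda>I. F_mer p (x * (\<Prod>i\<in>I. xs ! i) # nths xs (- I))"
  have len: "n - 1 = length xs" using n by auto
  have p: "0 < norm p" "norm p < 1"
    using q power_less_one_iff[of "norm p" 2] unfolding root[symmetric] by (auto simp: norm_power)
  have lhs': "squares (p * x # xs) \<in> Delta (p ^ 2)" using lhs root by (simp add: regular_dom_def)
  have rhs': "squares (x * (\<Prod>i\<in>I. xs ! i) # nths xs (- I)) \<in> Delta (p ^ 2)" if "I \<subseteq> ?n" for I
    using rhs[of I] that root len by (simp add: regular_dom_def)

  \<comment> \<open>The lower bound in \<open>Delta\<close> is applied to the left-hand arguments at
    the head and at \<open>I\<close>, shifted by one past the head. The factor \<open>norm q\<close>
    then cancels.\<close>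
  have inside: "norm (x * (\<Prod>i\<in>I. xs ! i)) > 1" if I: "I \<subseteq> ?n" for I
  proof (rule norm_root_gt_1)
    let ?J = "insert 0 (Suc ` I)"
    have finI: "finite I" using I finite_subset by blast
    have "(\<Prod>i\<in>I. squares (p * x # xs) ! Suc i) = (\<Prod>i\<in>I. (xs ! i) ^ 2)"
      using I by (intro prod.cong) (auto simp: squares_def)
    hence "(\<Prod>i\<in>?J. squares (p * x # xs) ! i) = (p * x) ^ 2 * (\<Prod>i\<in>I. (xs ! i) ^ 2)"
      using finI by (simp add: prod.reindex squares_def)
    hence eq: "(\<Prod>i\<in>?J. squares (p * x # xs) ! i) = p ^ 2 * (x * (\<Prod>i\<in>I. xs ! i)) ^ 2"
      by (simp add: power_mult_distrib prod_power_distrib)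
    have "?J \<subseteq> {..<length (squares (p * x # xs))}" "?J \<noteq> {}"
      using I by (auto simp: squares_def)
    hence "norm (p ^ 2) < norm (\<Prod>i\<in>?J. squares (p * x # xs) ! i)"
      using lhs' unfolding Delta_def by blast
    hence "norm (p ^ 2) * 1 < norm (p ^ 2) * norm ((x * (\<Prod>i\<in>I. xs ! i)) ^ 2)"
      unfolding eq by (simp only: norm_mult mult_1_right)
    thus "norm ((x * (\<Prod>i\<in>I. xs ! i)) ^ 2) > 1"
      by (rule mult_less_cancel_left_pos[THEN iffD1, rotated]) (use p in simp)
  qed
  \<comment> \<open>The right-hand term with \<open>I = {}\<close> bounds
    \<open>norm (x ^ 2)\<close> by \<open>1 / norm q\<close>.\<close>
  have outside: "0 < norm (p * x)" "norm (p * x) < 1"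
  proof -
    show "0 < norm (p * x)" using inside[of "{}"] p by auto
    have "squares (x # xs) \<in> Delta (p ^ 2)" using rhs'[of "{}"] by (simp add: nths_all)
    hence "norm (\<Prod>i\<in>{0}. squares (x # xs) ! i) < 1 / norm (p ^ 2)"
      unfolding Delta_def by (elim CollectE allE[of _ "{0}"]) (simp add: squares_def)
    hence "norm (p * x) ^ 2 < 1"
      using p by (simp add: squares_def norm_power norm_mult power_mult_distrib field_simps)
    thus "norm (p * x) < 1" by (simp add: power_less_one_iff)
  qed

  let ?t = "\<lambda>S j. p ^ energy2 S * x powi (2 * j + 1) * prod_list (map (\<lambda>u. eig u (S - {j})) xs)"
  have "((\<lambda>z. \<Sum>I\<in>Pow ?n. (-1) ^ card I * (case z of (S, j) \<Rightarrow>
            p ^ energy2 S * (x * (\<Prod>i\<in>I. xs ! i)) powi (2 * j + 1) *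
              prod_list (map (\<lambda>u. eig u S) (nths xs (- I)))))
          has_sum (\<Sum>I\<in>Pow ?n. (-1) ^ card I * ?F I)) (Sigma maya (\<lambda>S. S))"
    by (intro has_sum_finite_sum has_sum_cmult_right F_mer_has_sum_inside rhs' p inside) auto
  also have "?this \<longleftrightarrow> ((\<lambda>(S, j). ?t S j) has_sum (\<Sum>I\<in>Pow ?n. (-1) ^ card I * ?F I)) (Sigma maya (\<lambda>S. S))"
  proof (rule has_sum_cong)
    fix z assume "z \<in> Sigma maya (\<lambda>S. S)"
    then obtain S j where z: "z = (S, j)" "S \<in> maya" "j \<in> S" by auto
    show "(\<Sum>I\<in>Pow ?n. (-1) ^ card I * (case z of (S, j) \<Rightarrow>
            p ^ energy2 S * (x * (\<Prod>i\<in>I. xs ! i)) powi (2 * j + 1) *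
              prod_list (map (\<lambda>u. eig u S) (nths xs (- I))))) = (case z of (S, j) \<Rightarrow> ?t S j)"
      unfolding z(1) prod.case mult.assoc inclusion_exclusion_eig[OF z(2,3), symmetric]
      by (simp add: sum_distrib_left mult_ac)
  qed
  also have "\<dots> \<longleftrightarrow> ((\<lambda>(S, j). p ^ energy2 S * (p * x) powi (2 * j + 1) * prod_list (map (\<lambda>u. eig u S) xs))
      has_sum (\<Sum>I\<in>Pow ?n. (-1) ^ card I * ?F I)) (Sigma maya (\<lambda>S. - S))"
  \<comment> \<open>Moving \<open>j\<close> out of \<open>S\<close> matches the index sets of the
    two sides; the energy change releases \<open>p powi (2 * j + 1)\<close>, which turns
    \<open>x\<close> into \<open>p * x\<close>.\<close>
  proof (rule has_sum_reindex_bij_witness[where i = "\<lambda>(S, j). (insert j S, j)" and j = "\<lambda>(S, j). (S - {j}, j)"])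
    fix z assume "z \<in> Sigma maya (\<lambda>S. S)"
    then obtain S j where z: "z = (S, j)" "S \<in> maya" "j \<in> S" by auto
    have "p ^ energy2 S = p ^ energy2 (S - {j}) * p powi (2 * j + 1)"
      using power_energy2_insert[of "S - {j}" j p] z p by (simp add: maya_remove insert_absorb)
    thus "(case (case z of (S, j) \<Rightarrow> (S - {j}, j)) of (S, j) \<Rightarrow>
             p ^ energy2 S * (p * x) powi (2 * j + 1) * prod_list (map (\<lambda>u. eig u S) xs))
        = (case z of (S, j) \<Rightarrow> ?t S j)"
      by (simp add: z(1) power_int_mult_distrib mult_ac)
  qed (auto simp: maya_insert maya_remove)
  finally have "(\<Sum>I\<in>Pow ?n. (-1) ^ card I * ?F I) = - F_mer p (p * x # xs)"
    by (rule has_sum_unique) (rule F_mer_has_sum_outside[OF lhs' p outside])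
  hence "F_mer p (p * x # xs) = (\<Sum>I\<in>Pow ?n. (-1) ^ (card I + 1) * ?F I)"
    by (simp add: sum_negf)
  \<comment> \<open>The subsets are grouped by cardinality.\<close>
  also have "\<dots> = (\<Sum>s = 0..length xs. \<Sum>I | I \<in> Pow ?n \<and> card I = s. (-1) ^ (card I + 1) * ?F I)"
    using card_mono[OF finite_lessThan, of _ "length xs"]
    by (intro sum.group[symmetric]) auto
  also have "\<dots> = (\<Sum>s = 0..n - 1. (-1) ^ (s + 1) * (\<Sum>I | I \<subseteq> {..<n - 1} \<and> card I = s. ?F I))"
    unfolding sum_distrib_left len by (intro sum.cong) auto
  finally show ?thesis .
qed

end
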